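(* Let $k>1$ be an integer, $n\ge 1$, $\sigma$ a permutation of $\{0,1,\ldots,n\}$, and let $r=[a_0;a_1,\ldots,a_n]$ be a $(\sigma,k)$-permutiple with $r'=[a_{\sigma(0)};a_{\sigma(1)},\ldots,a_{\sigma(n)}]$. Let $(\gamma_j)$ and $(\gamma'_j)$ be the tails of $r$ and $r'$. Then the following are equivalent: (1) $r$ is continuant-preserving, i.e. $K_{n+1}(a_0,a_1,\ldots,a_n)=K_{n+1}(a_{\sigma(0)},a_{\sigma(1)},\ldots,a_{\sigma(n)})$; (2) $K_{n}(a_{\sigma(1)},\ldots,a_{\sigma(n)})=k\,K_{n}(a_1,\ldots,a_n)$; (3) $\gamma_0\gamma_1\cdots\gamma_{n-1}=k\,\gamma'_0\gamma'_1\cdots\gamma'_{n-1}$.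
   Context: For positive integers $a_0,\ldots,a_n$, $[a_0;a_1,\ldots,a_n]$ denotes the finite simple continued fraction $a_0+\cfrac{1}{a_1+\cfrac{1}{\ddots+\cfrac{1}{a_n}}}$. All finite continued fractions are assumed to be in canonical form (last digit at least $2$ when there are at least two digits). For an integer $k>1$ and a permutation $\sigma$ of $\{0,\ldots,n\}$, $r=[a_0;a_1,\ldots,a_n]$ is a $(\sigma,k)$-permutiple if $r=k\,[a_{\sigma(0)};a_{\sigma(1)},\ldots,a_{\sigma(n)}]$. Continuants: $K_0()=1$, $K_1(x_0)=x_0$, and $K_m(x_0,\ldots,x_{m-1})=x_{m-1}K_{m-1}(x_0,\ldots,x_{m-2})+K_{m-2}(x_0,\ldots,x_{m-3})$. Define $G:[0,\infty)\to[0,1)$ by $G(0)=0$ and $G(x)=\frac1x-\lfloor\frac1x\rfloor$ for $x>0$. The tails of $r$ are $\gamma_0=r-\lfloor r\rfloor$, $\gamma_{j+1}=G(\gamma_j)$; the tails $\gamma'_j$ of $r'$ are defined in the same way from $r'$. *)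

theory Defs
  imports Complex_Main "HOL-Combinatorics.Permutations"
begin

text \<open>Digit sequences are functions on \<open>nat\<close> of which only finitely many values are used:
  \<open>cfrac n a\<close> is $[a_0;a_1,\ldots,a_n]$ (with $n+1$ digits), whereas
  \<open>continuant m x\<close> is $K_m(x_0,\ldots,x_{m-1})$ (with $m$ arguments).\<close>

fun cfrac :: "nat \<Rightarrow> (nat \<Rightarrow> nat) \<Rightarrow> real" where
  "cfrac 0 a = real (a 0)"
| "cfrac (Suc n) a = real (a 0) + 1 / cfrac n (\<lambda>i. a (Suc i))"

definition canonical_digits :: "nat \<Rightarrow> (nat \<Rightarrow> nat) \<Rightarrow> bool" where
  "canonical_digits n a \<longleftrightarrow> (\<forall>i\<le>n. a i > 0) \<and> (n \<ge> 1 \<longrightarrow> a n \<ge> 2)"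

fun continuant :: "nat \<Rightarrow> (nat \<Rightarrow> nat) \<Rightarrow> nat" where
  "continuant 0 x = 1"
| "continuant (Suc 0) x = x 0"
| "continuant (Suc (Suc m)) x = x (Suc m) * continuant (Suc m) x + continuant m x"

text \<open>Both expansions, that of $r$ and the permuted one, are required to be canonical.
  A canonical expansion is determined by its value, so the notion is stated for digits.\<close>

definition permutiple :: "(nat \<Rightarrow> nat) \<Rightarrow> nat \<Rightarrow> nat \<Rightarrow> (nat \<Rightarrow> nat) \<Rightarrow> bool" where
  "permutiple \<sigma> k n a \<longleftrightarrow>
     canonical_digits n a \<and> canonical_digits n (\<lambda>i. a (\<sigma> i)) \<and>
     cfrac n a = real k * cfrac n (\<lambda>i. a (\<sigma> i))"

definition continuant_preserving :: "(nat \<Rightarrow> nat) \<Rightarrow> nat \<Rightarrow> (nat \<Rightarrow> nat) \<Rightarrow> bool" where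
  "continuant_preserving \<sigma> n a \<longleftrightarrow>
     continuant (n + 1) a = continuant (n + 1) (\<lambda>i. a (\<sigma> i))"

text \<open>The Gauss map; it is only ever applied to nonnegative arguments.\<close>

definition gauss_map :: "real \<Rightarrow> real" where
  "gauss_map x = (if x = 0 then 0 else 1 / x - of_int \<lfloor>1 / x\<rfloor>)"

fun tail :: "real \<Rightarrow> nat \<Rightarrow> real" where
  "tail r 0 = r - of_int \<lfloor>r\<rfloor>"
| "tail r (Suc j) = gauss_map (tail r j)"

end

theory Submission
  imports Defs
begin

text \<open>Write $Q = K_n(a_1,\ldots,a_n)$ and $Q'$ for its permuted analogue. Since
  $r = K_{n+1}(a_0,\ldots,a_n)/Q$ and likewise for $r'$, the equation $r = k r'$ reads
  $K_{n+1}(a_0,\ldots,a_n)\,Q' = k\,K_{n+1}(a_{\sigma(0)},\ldots,a_{\sigma(n)})\,Q$, so the two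
  numerators agree iff $Q' = kQ$. Moreover $\gamma_j = 1/[a_{j+1};\ldots,a_n]$, and the product of
  these complete quotients telescopes to $Q$, so $\gamma_0\cdots\gamma_{n-1} = 1/Q$.\<close>

text \<open>\<open>continuant\<close> recurses on its last argument and \<open>cfrac\<close> on its
  first, so relating them needs the recursion from the front. Expanding at both ends gives the same
  four terms, whichever end is expanded first.\<close>

lemma continuant_front:
  "continuant (Suc (Suc m)) x =
     x 0 * continuant (Suc m) (\<lambda>i. x (Suc i)) + continuant m (\<lambda>i. x (Suc (Suc i)))"
proof (induction m rule: less_induct)
  case (less m)
  \<comment> \<open>The last-argument recursion reaches two steps back and must also apply to
    \<open>continuant m\<close> of the doubly shifted sequence, hence two base cases.\<close>
  consider "m = 0" | "m = 1" | l where "m = Suc (Suc l)"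
    by (metis One_nat_def not0_implies_Suc)
  then show ?case
  proof cases
    case 3
    have "continuant (Suc (Suc m)) x =
        x (Suc m) * continuant (Suc (Suc (Suc l))) x + continuant (Suc (Suc l)) x"
      unfolding 3 by (rule continuant.simps(3))
    also have "\<dots> = x (Suc m) * (x 0 * continuant (Suc (Suc l)) (\<lambda>i. x (Suc i))
          + continuant (Suc l) (\<lambda>i. x (Suc (Suc i))))
        + (x 0 * continuant (Suc l) (\<lambda>i. x (Suc i)) + continuant l (\<lambda>i. x (Suc (Suc i))))"
      by (simp only: less.IH[of l] less.IH[of "Suc l"] 3 lessI less_SucI)
    also have "\<dots> = x 0 * (x (Suc m) * continuant (Suc (Suc l)) (\<lambda>i. x (Suc i))
          + continuant (Suc l) (\<lambda>i. x (Suc i)))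
        + (x (Suc m) * continuant (Suc l) (\<lambda>i. x (Suc (Suc i)))
          + continuant l (\<lambda>i. x (Suc (Suc i))))"
      by (simp only: algebra_simps)
    finally show ?thesis
      by (simp only: 3 continuant.simps(3))
  qed simp_all
qed

lemma continuant_pos: "(\<And>i. i < m \<Longrightarrow> x i > 0) \<Longrightarrow> continuant m x > 0"
  by (induction m x rule: continuant.induct) auto

lemma cfrac_pos: "(\<And>i. i \<le> n \<Longrightarrow> a i > 0) \<Longrightarrow> cfrac n a > 0"
  by (induction n arbitrary: a) (auto intro!: add_pos_pos)

text \<open>The bound on the last digit matters when it is the only one: a lone digit 1 would give
  the value 1. Otherwise a positive fraction is added to a digit that is at least 1. Strictness
  makes the reciprocal a genuine fractional part.\<close>

lemma cfrac_gt_1: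
  assumes "\<And>i. i \<le> n \<Longrightarrow> a i > 0" and "a n \<ge> 2"
  shows "cfrac n a > 1"
proof (cases n)
  case 0
  then show ?thesis using assms by simp
next
  case (Suc m)
  have "1 / cfrac m (\<lambda>i. a (Suc i)) > 0"
    using assms Suc by (intro divide_pos_pos cfrac_pos) auto
  moreover have "real (a 0) \<ge> 1"
    using assms(1)[of 0] by simp
  ultimately show ?thesis
    unfolding Suc cfrac.simps by linarith
qed

lemma cfrac_mult_continuant:
  assumes "\<And>i. i \<le> n \<Longrightarrow> a i > 0"
  shows "cfrac n a * real (continuant n (\<lambda>i. a (Suc i))) = real (continuant (Suc n) a)"
  using assms
proof (induction n arbitrary: a)
  case (Suc n)
  let ?c = "cfrac n (\<lambda>i. a (Suc i))"
  have "?c > 0"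
    using Suc.prems by (intro cfrac_pos) auto
  moreover have "?c * real (continuant n (\<lambda>i. a (Suc (Suc i)))) = real (continuant (Suc n) (\<lambda>i. a (Suc i)))"
    using Suc.prems by (intro Suc.IH) auto
  ultimately show ?case
    unfolding continuant_front by (simp add: field_simps)
qed simp

lemma tail_cfrac_0:
  assumes "\<And>i. i \<le> Suc n \<Longrightarrow> a i > 0" and "a (Suc n) \<ge> 2"
  shows "tail (cfrac (Suc n) a) 0 = 1 / cfrac n (\<lambda>i. a (Suc i))"
proof -
  have "cfrac n (\<lambda>i. a (Suc i)) > 1"
    using assms by (intro cfrac_gt_1) auto
  then have "\<lfloor>cfrac (Suc n) a\<rfloor> = int (a 0)"
    by (intro floor_unique) auto
  then show ?thesis by simp
qed

text \<open>All content is in j = 0: with x the complete quotient after the first digit, the Gauss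
  map sends 1/x to x minus its floor, which is the initial tail of x. Both sides then evolve under
  the same map.\<close>

lemma tail_cfrac_Suc:
  assumes "\<And>i. i \<le> Suc n \<Longrightarrow> a i > 0" and "a (Suc n) \<ge> 2"
  shows "tail (cfrac (Suc n) a) (Suc j) = tail (cfrac n (\<lambda>i. a (Suc i))) j"
proof (induction j)
  case 0
  have "cfrac n (\<lambda>i. a (Suc i)) > 1"
    using assms by (intro cfrac_gt_1) auto
  moreover have "tail (cfrac (Suc n) a) 0 = 1 / cfrac n (\<lambda>i. a (Suc i))"
    using assms by (rule tail_cfrac_0)
  ultimately show ?case
    by (simp only: tail.simps(2)) (simp add: gauss_map_def)
next
  case (Suc j)
  then show ?case by (simp only: tail.simps(2))
qed

text \<open>Splitting off the factor j = 0 leaves the product for the shifted digits.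
  \<open>cfrac_mult_continuant\<close>, applied to those digits, absorbs the split-off complete
  quotient into the next larger continuant.\<close>

lemma prod_tail_cfrac:
  assumes "\<And>i. i \<le> n \<Longrightarrow> a i > 0" and "a n \<ge> 2"
  shows "(\<Prod>j<n. tail (cfrac n a) j) = 1 / real (continuant n (\<lambda>i. a (Suc i)))"
  using assms
proof (induction n arbitrary: a)
  case (Suc n)
  have "tail (cfrac (Suc n) a) 0 = 1 / cfrac n (\<lambda>i. a (Suc i))"
    using Suc.prems by (rule tail_cfrac_0)
  moreover have "tail (cfrac (Suc n) a) (Suc j) = tail (cfrac n (\<lambda>i. a (Suc i))) j" for j
    using Suc.prems by (rule tail_cfrac_Suc)
  ultimately have "(\<Prod>j<Suc n. tail (cfrac (Suc n) a) j)
      = 1 / cfrac n (\<lambda>i. a (Suc i)) * (\<Prod>j<n. tail (cfrac n (\<lambda>i. a (Suc i))) j)"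
    by (simp only: prod.lessThan_Suc_shift)
  also have "(\<Prod>j<n. tail (cfrac n (\<lambda>i. a (Suc i))) j)
      = 1 / real (continuant n (\<lambda>i. a (Suc (Suc i))))"
    using Suc.prems by (intro Suc.IH) auto
  finally show ?case
    using Suc.prems cfrac_mult_continuant[of n "\<lambda>i. a (Suc i)"] by simp
qed simp

theorem theorem5:
  fixes k n :: nat and \<sigma> a :: "nat \<Rightarrow> nat" and r r' :: real
  assumes "k > 1" and "n \<ge> 1" and "\<sigma> permutes {0..n}"
    and "permutiple \<sigma> k n a"
    and "r = cfrac n a" and "r' = cfrac n (\<lambda>i. a (\<sigma> i))"
  shows "(continuant_preserving \<sigma> n a \<longleftrightarrow>
            continuant n (\<lambda>i. a (\<sigma> (i + 1))) = k * continuant n (\<lambda>i. a (i + 1)))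
       \<and> (continuant n (\<lambda>i. a (\<sigma> (i + 1))) = k * continuant n (\<lambda>i. a (i + 1)) \<longleftrightarrow>
            (\<Prod>j<n. tail r j) = real k * (\<Prod>j<n. tail r' j))"
proof -
  define b where "b = (\<lambda>i. a (\<sigma> i))"
  define P P' Q Q' where "P = continuant (Suc n) a" and "P' = continuant (Suc n) b"
    and "Q = continuant n (\<lambda>i. a (Suc i))" and "Q' = continuant n (\<lambda>i. b (Suc i))"
  \<comment> \<open>Since n \<ge> 1, canonicity bounds the last digit of both expansions.\<close>
  have a: "\<And>i. i \<le> n \<Longrightarrow> a i > 0" "a n \<ge> 2" and b: "\<And>i. i \<le> n \<Longrightarrow> b i > 0" "b n \<ge> 2"
    and r: "r = real k * r'"
    using assms by (auto simp: permutiple_def canonical_digits_def b_def)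
  have pos: "P' > 0" "Q > 0" "Q' > 0"
    unfolding P'_def Q_def Q'_def using a b by (auto intro!: continuant_pos)
  have "r * real Q = real P" "r' * real Q' = real P'"
    unfolding P_def P'_def Q_def Q'_def assms(5,6) b_def[symmetric]
    using a b by (auto intro!: cfrac_mult_continuant)
  then have "real (P * Q') = real (P' * (k * Q))"
    using r by (simp flip: \<open>r * real Q = real P\<close> \<open>r' * real Q' = real P'\<close>)
  then have eq: "P * Q' = P' * (k * Q)"
    by (simp only: of_nat_eq_iff)
  \<comment> \<open>One direction cancels P' in \<open>eq\<close>, the other cancels Q'; both are
    positive.\<close>
  have "P = P' \<longleftrightarrow> Q' = k * Q"
  proof
    assume "P = P'"
    then show "Q' = k * Q" using eq pos(1) by simp
  next
    assume "Q' = k * Q"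
    then show "P = P'" using eq pos(3) by simp
  qed
  moreover have "(\<Prod>j<n. tail r j) = 1 / real Q" "(\<Prod>j<n. tail r' j) = 1 / real Q'"
    unfolding Q_def Q'_def assms(5,6) b_def[symmetric]
    by (intro prod_tail_cfrac a b; assumption)+
  moreover have "1 / real Q = real k * (1 / real Q') \<longleftrightarrow> Q' = k * Q"
  proof -
    have "1 / real Q = real k * (1 / real Q') \<longleftrightarrow> real Q' = real (k * Q)"
      using pos by (simp add: field_simps)
    then show ?thesis by (simp only: of_nat_eq_iff)
  qed
  ultimately show ?thesis
    by (simp add: continuant_preserving_def P_def P'_def Q_def Q'_def b_def)
qed

end
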